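(* Suppose there is $\mu\in\mathbb{R}$ such that for every $m\in[M]$ the function $f_m$ is locally Lipschitz and $\mu$-weakly convex on $\mathcal{X}$. Let $l\ge 0$ and $\tau>0$. Then the function $v_{l,\tau}$ satisfies: 1. For all $x\in\mathcal{X}$, $\bar u(x)-\tau\ln M\le v_{0,\tau}(x)\le \bar u(x)$. Furthermore, $\min_{x\in\mathcal{X}} v_{l,\tau}(x)=-\tau\ln M$. 2. If $x\in\mathcal{X}$ is weakly Pareto optimal, then $v_{l,\tau}(x)\le 0$. Conversely, for $x\in\mathcal{X}$: (a) if $l=0$ and $v_{l,\tau}(x)\le 0$, then $x$ is $\epsilon$-weakly Pareto optimal with $\epsilon=\tau\ln M$; (b) if $l>0$, $v_{l,\tau}(x)\le-\tau\ln M$, and for all $m\in[M]$ the function $f_m$ is $(1,0)$-point quasar-convex at $x$, then $x$ is weakly Pareto optimal.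
   Context: Setting: $q,M\ge 1$ are integers, $[M]=\{1,\dots,M\}$, $\mathcal{X}\subseteq\mathbb{R}^q$ is nonempty, closed and convex. The functions $f_1,\dots,f_M:\mathcal{X}\to\mathbb{R}$ are proper, bounded below and twice continuously differentiable, and $F=(f_1,\dots,f_M)$. Let $\Delta^M=\{\lambda\in\mathbb{R}^M:\lambda\ge0,\ \sum_m\lambda_m=1\}$. It is assumed throughout that for every $\lambda\in\Delta^M$ a minimizer of $\lambda^\top F$ over $\mathcal{X}$ exists. Define $\bar u(x)=\sup_{y\in\mathcal{X}}\min_{m\in[M]}\{f_m(x)-f_m(y)\}$, and for $l\ge 0,\tau>0$, $$h_{l,\tau}(x,y)=\tau\ln\Big(\sum_{m=1}^M e^{(f_m(y)-f_m(x))/\tau}\Big)+\tfrac{l}{2}\|x-y\|^2,\qquad v_{l,\tau}(x)=-\min_{y\in\mathcal{X}}h_{l,\tau}(x,y).$$ For vectors, $v<w$ means $v_i<w_i$ for all $i$. A point $x\in\mathcal{X}$ is weakly Pareto optimal if there is no $x'\in\mathcal{X}$ with $F(x')<F(x)$. It is $\epsilon$-weakly Pareto optimal if there is no $x'\in\mathcal{X}$, $x'\ne x$, with $F(x')<F(x)-\epsilon\mathbf{1}$, where $\mathbf 1$ is the all-one vector. A locally Lipschitz function $f:\mathcal{X}\to\mathbb{R}$ is $\mu$-weakly convex ($\mu\in\mathbb{R}$, possibly negative) if $f(x)-\frac{\mu}{2}\|x\|^2$ is convex on $\mathcal{X}$. A function $f:\mathcal{X}\to\mathbb{R}$ is $(c_q,\mu)$-point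 (strong) quasar-convex at $x^*\in\mathcal{X}$, with $c_q\in(0,1]$, $\mu\ge 0$, if for all $x\in\mathcal{X}$, $f(x^* )\ge f(x)+\frac{1}{c_q}\nabla f(x)^\top(x^*-x)+\frac{\mu}{2}\|x^*-x\|^2$. *)

theory Defs
  imports "HOL-Analysis.Analysis"
begin

(* Throughout, the index set [M] is a finite type 'm, so that M = CARD('m), and a function on the
   feasible set X is a total function of which only the values on X matter. *)

definition objective_vector :: "('m::finite \<Rightarrow> 'a \<Rightarrow> real) \<Rightarrow> 'a \<Rightarrow> real ^ 'm" where
  "objective_vector f x = (\<chi> m. f m x)"

definition prob_simplex :: "(real ^ 'm::finite) set" where
  "prob_simplex = {w. (\<forall>m. 0 \<le> w $ m) \<and> (\<Sum>m\<in>UNIV. w $ m) = 1}"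

(* The library's (<) on real ^ 'm is the strict part of the componentwise order, which is weaker
   than strict inequality in every component. *)
definition vec_less :: "real ^ 'm::finite \<Rightarrow> real ^ 'm \<Rightarrow> bool" where
  "vec_less v w \<longleftrightarrow> (\<forall>i. v $ i < w $ i)"

definition weakly_pareto_optimal :: "'a set \<Rightarrow> ('m::finite \<Rightarrow> 'a \<Rightarrow> real) \<Rightarrow> 'a \<Rightarrow> bool" where
  "weakly_pareto_optimal X f x \<longleftrightarrow>
     x \<in> X \<and> \<not> (\<exists>x'\<in>X. vec_less (objective_vector f x') (objective_vector f x))"

definition eps_weakly_pareto_optimal ::
  "real \<Rightarrow> 'a set \<Rightarrow> ('m::finite \<Rightarrow> 'a \<Rightarrow> real) \<Rightarrow> 'a \<Rightarrow> bool" where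
  "eps_weakly_pareto_optimal \<epsilon> X f x \<longleftrightarrow>
     x \<in> X \<and>
     \<not> (\<exists>x'\<in>X. x' \<noteq> x \<and>
          vec_less (objective_vector f x') (objective_vector f x - \<epsilon> *\<^sub>R (\<chi> m. 1)))"

(* Derivatives are taken within X, since the functions are only given on X. Where X has empty
   interior the gradient is not unique, but for convex X its inner products with y - x,
   for x and y in X, are. *)
definition twice_continuously_differentiable_on ::
  "(real ^ 'q::finite) set \<Rightarrow> (real ^ 'q \<Rightarrow> real) \<Rightarrow> bool" where
  "twice_continuously_differentiable_on X f \<longleftrightarrow>
     (\<exists>(g :: real ^ 'q \<Rightarrow> real ^ 'q) (H :: real ^ 'q \<Rightarrow> real ^ 'q ^ 'q).
        (\<forall>x\<in>X. (f has_derivative (\<lambda>d. g x \<bullet> d)) (at x within X)) \<and>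
        (\<forall>x\<in>X. (g has_derivative (\<lambda>d. H x *v d)) (at x within X)) \<and>
        continuous_on X H)"

definition locally_lipschitz_on ::
  "'a::metric_space set \<Rightarrow> ('a \<Rightarrow> real) \<Rightarrow> bool" where
  "locally_lipschitz_on X f \<longleftrightarrow> (\<forall>x\<in>X. \<exists>r>0. \<exists>L. L-lipschitz_on (ball x r \<inter> X) f)"

definition weakly_convex_on ::
  "real \<Rightarrow> 'a::real_normed_vector set \<Rightarrow> ('a \<Rightarrow> real) \<Rightarrow> bool" where
  "weakly_convex_on \<mu> X f \<longleftrightarrow>
     locally_lipschitz_on X f \<and> convex_on X (\<lambda>x. f x - \<mu> / 2 * (norm x)\<^sup>2)"

(* g is the gradient of f at the running point x, not at xs; for convex X the choice of g among
   the gradients within X is immaterial. *)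
definition point_quasar_convex ::
  "real \<Rightarrow> real \<Rightarrow> 'a::real_inner set \<Rightarrow> ('a \<Rightarrow> real) \<Rightarrow> 'a \<Rightarrow> bool" where
  "point_quasar_convex c \<mu> X f xs \<longleftrightarrow>
     0 < c \<and> c \<le> 1 \<and> 0 \<le> \<mu> \<and> xs \<in> X \<and>
     (\<forall>x\<in>X. \<exists>g. (f has_derivative (\<lambda>d. g \<bullet> d)) (at x within X) \<and>
        f xs \<ge> f x + 1 / c * (g \<bullet> (xs - x)) + \<mu> / 2 * (norm (xs - x))\<^sup>2)"

definition u_bar :: "'a set \<Rightarrow> ('m::finite \<Rightarrow> 'a \<Rightarrow> real) \<Rightarrow> 'a \<Rightarrow> real" where
  "u_bar X f x = (SUP y\<in>X. MIN m. f m x - f m y)"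

definition h_smooth ::
  "('m::finite \<Rightarrow> 'a::real_normed_vector \<Rightarrow> real) \<Rightarrow> real \<Rightarrow> real \<Rightarrow> 'a \<Rightarrow> 'a \<Rightarrow> real" where
  "h_smooth f l \<tau> x y =
     \<tau> * ln (\<Sum>m\<in>UNIV. exp ((f m y - f m x) / \<tau>)) + l / 2 * (norm (x - y))\<^sup>2"

(* The infimum is the minimum whenever the latter is attained. It is finite when the f m are
   bounded below, but for l = 0 it need not be attained. *)
definition v_smooth ::
  "'a::real_normed_vector set \<Rightarrow> ('m::finite \<Rightarrow> 'a \<Rightarrow> real) \<Rightarrow> real \<Rightarrow> real \<Rightarrow> 'a \<Rightarrow> real" where
  "v_smooth X f l \<tau> x = - (INF y\<in>X. h_smooth f l \<tau> x y)"

end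

theory Submission
  imports Defs
begin

text \<open>
  Up to the quadratic term, \<^const>\<open>h_smooth\<close> is the log-sum-exp smoothing of the function
  \<open>y \<mapsto> Max\<^sub>m (f m y - f m x)\<close>. Everything rests on three estimates of log-sum-exp. It dominates
  each of its arguments, and it exceeds their maximum by at most \<open>\<tau> ln M\<close>; this
  sandwich compares \<^const>\<open>v_smooth\<close> with \<^const>\<open>u_bar\<close> and gives the two implications
  between weak Pareto optimality and the sign of \<^const>\<open>v_smooth\<close>. It also exceeds the arithmetic mean by
  at least \<open>\<tau> ln M\<close>, with equality for constant arguments (lemma \<open>mean_le_smooth_max\<close>). Taking
  \<open>y = x\<close> shows \<open>v_smooth \<ge> - \<tau> ln M\<close> everywhere, and by the mean estimate this bound is reached
  at every minimizer of \<open>\<Sum>m. f m\<close>, that is, at the minimizer for the uniform weights.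

  For \<open>l > 0\<close> the bound \<open>v_smooth \<le> - \<tau> ln M\<close> says that \<open>x\<close> itself minimizes \<open>h_smooth f l \<tau> x\<close>.
  Point quasar-convexity at \<open>x\<close> makes each \<open>f m\<close> lie below its chords emanating from \<open>x\<close>
  (lemma \<open>point_quasar_convex_below_chord\<close>). If some \<open>x'\<close> improved all objectives at once, moving from \<open>x\<close>
  a fraction \<open>t\<close> of the way to \<open>x'\<close> would thus lower the log-sum-exp term at least linearly in \<open>t\<close>
  at a cost of order \<open>t\<^sup>2\<close>, so \<open>x\<close> would not be a minimizer.
\<close>

section \<open>Log-sum-exp as a smooth maximum\<close>

definition smooth_max :: "real \<Rightarrow> ('m::finite \<Rightarrow> real) \<Rightarrow> real" where
  "smooth_max \<tau> a = \<tau> * ln (\<Sum>m\<in>UNIV. exp (a m / \<tau>))"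

lemma sum_exp_pos: "(\<Sum>m\<in>(UNIV::'m::finite set). exp (a m :: real)) > 0"
  by (rule sum_pos) auto

lemma le_smooth_max:
  fixes a :: "'m::finite \<Rightarrow> real"
  assumes "\<tau> > 0"
  shows "a m \<le> smooth_max \<tau> a"
proof -
  have "exp (a m / \<tau>) \<le> (\<Sum>m\<in>UNIV. exp (a m / \<tau>))"
    by (rule member_le_sum) auto
  then have "a m / \<tau> \<le> ln (\<Sum>m\<in>UNIV. exp (a m / \<tau>))"
    by (simp add: ln_ge_iff sum_exp_pos)
  then show ?thesis
    using assms by (simp add: smooth_max_def pos_divide_le_eq mult.commute)
qed

lemma smooth_max_const:
  fixes c :: real
  assumes "\<tau> > 0"
  shows "smooth_max \<tau> (\<lambda>_::'m::finite. c) = c + \<tau> * ln (real CARD('m))"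
  using assms by (simp add: smooth_max_def ln_mult algebra_simps)

lemma smooth_max_mono:
  fixes a b :: "'m::finite \<Rightarrow> real"
  assumes "\<tau> > 0" and "\<And>m. a m \<le> b m"
  shows "smooth_max \<tau> a \<le> smooth_max \<tau> b"
proof -
  have "(\<Sum>m\<in>UNIV. exp (a m / \<tau>)) \<le> (\<Sum>m\<in>UNIV. exp (b m / \<tau>))"
    using assms by (intro sum_mono) (simp add: divide_right_mono)
  then show ?thesis
    using assms by (simp add: smooth_max_def sum_exp_pos)
qed

lemma smooth_max_strict_mono:
  fixes a b :: "'m::finite \<Rightarrow> real"
  assumes "\<tau> > 0" and "\<And>m. a m < b m"
  shows "smooth_max \<tau> a < smooth_max \<tau> b"
proof -
  have "(\<Sum>m\<in>UNIV. exp (a m / \<tau>)) < (\<Sum>m\<in>UNIV. exp (b m / \<tau>))"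
    using assms by (intro sum_strict_mono) (simp_all add: divide_strict_right_mono)
  then show ?thesis
    using assms by (simp add: smooth_max_def sum_exp_pos)
qed

lemma smooth_max_le:
  fixes a :: "'m::finite \<Rightarrow> real"
  assumes "\<tau> > 0" and "\<And>m. a m \<le> c"
  shows "smooth_max \<tau> a \<le> c + \<tau> * ln (real CARD('m))"
  using smooth_max_mono[of \<tau> a "\<lambda>_. c"] assms by (simp add: smooth_max_const)

text \<open>
  This is Jensen's inequality for \<open>exp\<close>. The tangent line \<open>1 + u \<le> exp u\<close> at the mean is
  enough, because the deviations from the mean sum to zero.
\<close>

lemma mean_le_smooth_max:
  fixes a :: "'m::finite \<Rightarrow> real"
  assumes "\<tau> > 0"
  shows "(\<Sum>m\<in>UNIV. a m) / real CARD('m) + \<tau> * ln (real CARD('m)) \<le> smooth_max \<tau> a"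
proof -
  define c where "c = (\<Sum>m\<in>UNIV. a m) / real CARD('m)"
  have zero: "(\<Sum>m\<in>UNIV. (a m - c) / \<tau>) = 0"
    by (simp add: sum_divide_distrib[symmetric] sum_subtractf c_def)
  have "real CARD('m) = (\<Sum>m\<in>UNIV. 1 + (a m - c) / \<tau>)"
    by (simp add: sum.distrib zero)
  also have "\<dots> \<le> (\<Sum>m\<in>UNIV. exp ((a m - c) / \<tau>))"
    by (intro sum_mono exp_ge_add_one_self)
  finally have "exp (c / \<tau>) * real CARD('m) \<le> exp (c / \<tau>) * (\<Sum>m\<in>UNIV. exp ((a m - c) / \<tau>))"
    by (intro mult_left_mono) auto
  also have "\<dots> = (\<Sum>m\<in>UNIV. exp (a m / \<tau>))"
    by (simp add: sum_distrib_left exp_add[symmetric] diff_divide_distrib)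
  finally have "ln (exp (c / \<tau>) * real CARD('m)) \<le> ln (\<Sum>m\<in>UNIV. exp (a m / \<tau>))"
    by (subst ln_le_cancel_iff) (simp_all add: sum_exp_pos)
  then have "c / \<tau> + ln (real CARD('m)) \<le> ln (\<Sum>m\<in>UNIV. exp (a m / \<tau>))"
    by (simp add: ln_mult)
  then have "\<tau> * (c / \<tau> + ln (real CARD('m))) \<le> smooth_max \<tau> a"
    unfolding smooth_max_def using assms by (intro mult_left_mono) auto
  then show ?thesis
    using assms by (simp add: c_def[symmetric] distrib_left)
qed

section \<open>The smoothed merit function\<close>

lemma h_smooth_eq_smooth_max:
  "h_smooth f l \<tau> x y = smooth_max \<tau> (\<lambda>m. f m y - f m x) + l / 2 * (norm (x - y))\<^sup>2"
  by (simp add: h_smooth_def smooth_max_def)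

lemma smooth_max_le_h_smooth:
  assumes "l \<ge> 0"
  shows "smooth_max \<tau> (\<lambda>m. f m y - f m x) \<le> h_smooth f l \<tau> x y"
  using assms by (simp add: h_smooth_eq_smooth_max)

lemma h_smooth_diag:
  fixes f :: "'m::finite \<Rightarrow> 'a::real_normed_vector \<Rightarrow> real"
  assumes "\<tau> > 0"
  shows "h_smooth f l \<tau> x x = \<tau> * ln (real CARD('m))"
  using smooth_max_const[OF assms, of 0, where 'm = 'm] by (simp add: h_smooth_eq_smooth_max)

lemma bdd_below_h_smooth:
  fixes f :: "'m::finite \<Rightarrow> 'a::real_normed_vector \<Rightarrow> real"
  assumes bdd: "bdd_below (f m ` X)" and "l \<ge> 0" and "\<tau> > 0"
  shows "bdd_below (h_smooth f l \<tau> x ` X)"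
proof -
  obtain B where B: "\<And>y. y \<in> X \<Longrightarrow> B \<le> f m y"
    using bdd by (auto simp: bdd_below_def)
  have "B - f m x \<le> h_smooth f l \<tau> x y" if "y \<in> X" for y
    using B[OF that] le_smooth_max[OF \<open>\<tau> > 0\<close>, of "\<lambda>m. f m y - f m x" m]
      smooth_max_le_h_smooth[OF \<open>l \<ge> 0\<close>, of \<tau> f y x] by linarith
  then show ?thesis
    by (auto simp: bdd_below_def)
qed

lemma v_smooth_le_iff:
  assumes "X \<noteq> {}" and "bdd_below (h_smooth f l \<tau> x ` X)"
  shows "v_smooth X f l \<tau> x \<le> c \<longleftrightarrow> (\<forall>y\<in>X. - c \<le> h_smooth f l \<tau> x y)"
  using le_cINF_iff[OF assms, of "- c"] by (simp add: v_smooth_def minus_le_iff)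

lemma v_smooth_ge:
  assumes "bdd_below (h_smooth f l \<tau> x ` X)" and "y \<in> X"
  shows "- h_smooth f l \<tau> x y \<le> v_smooth X f l \<tau> x"
  using cINF_lower[OF assms] by (simp add: v_smooth_def)

lemma u_bar_bounds_v_smooth:
  fixes f :: "'m::finite \<Rightarrow> 'a::real_normed_vector \<Rightarrow> real"
  assumes "X \<noteq> {}" and bdd: "bdd_below (f m0 ` X)" and "\<tau> > 0"
  shows "u_bar X f x - \<tau> * ln (real CARD('m)) \<le> v_smooth X f 0 \<tau> x"
    and "v_smooth X f 0 \<tau> x \<le> u_bar X f x"
proof -
  note h_bdd = bdd_below_h_smooth[where f = f, OF bdd order_refl \<open>\<tau> > 0\<close>]
  define g where "g y = (MIN m. f m x - f m y)" for y
  have u: "u_bar X f x = (SUP y\<in>X. g y)"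
    by (simp add: u_bar_def g_def)
  have g_le: "g y \<le> f m x - f m y" for m y
    by (simp add: g_def)
  have h0: "h_smooth f 0 \<tau> x y = smooth_max \<tau> (\<lambda>m. f m y - f m x)" for y
    by (simp add: h_smooth_eq_smooth_max)
  have "g y \<le> v_smooth X f 0 \<tau> x + \<tau> * ln (real CARD('m))" if "y \<in> X" for y
  proof -
    have "f m y - f m x \<le> - g y" for m
      using g_le[of y m] by linarith
    then have "smooth_max \<tau> (\<lambda>m. f m y - f m x) \<le> - g y + \<tau> * ln (real CARD('m))"
      by (rule smooth_max_le[OF \<open>\<tau> > 0\<close>])
    then show ?thesis
      using v_smooth_ge[OF h_bdd that, of x] by (simp add: h0)
  qed
  then have "u_bar X f x \<le> v_smooth X f 0 \<tau> x + \<tau> * ln (real CARD('m))"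
    unfolding u using \<open>X \<noteq> {}\<close> by (intro cSUP_least)
  then show "u_bar X f x - \<tau> * ln (real CARD('m)) \<le> v_smooth X f 0 \<tau> x"
    by simp
  obtain B where B: "\<And>y. y \<in> X \<Longrightarrow> B \<le> f m0 y"
    using bdd by (auto simp: bdd_below_def)
  have "g y \<le> f m0 x - B" if "y \<in> X" for y
    using g_le[of y m0] B[OF that] by linarith
  then have g_bdd: "bdd_above (g ` X)"
    by (auto simp: bdd_above_def)
  have "- u_bar X f x \<le> h_smooth f 0 \<tau> x y" if "y \<in> X" for y
  proof -
    have "g y \<in> range (\<lambda>m. f m x - f m y)"
      unfolding g_def by (rule Min_in) auto
    then obtain m where "g y = f m x - f m y"
      by auto
    then show ?thesis
      using le_smooth_max[OF \<open>\<tau> > 0\<close>, of "\<lambda>m. f m y - f m x" m] cSUP_upper[OF that g_bdd]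
      by (simp add: h0 u)
  qed
  then show "v_smooth X f 0 \<tau> x \<le> u_bar X f x"
    by (simp add: v_smooth_le_iff[OF \<open>X \<noteq> {}\<close> h_bdd])
qed

lemma v_smooth_ge_minus_ln_card:
  fixes f :: "'m::finite \<Rightarrow> 'a::real_normed_vector \<Rightarrow> real"
  assumes "bdd_below (f m ` X)" and "l \<ge> 0" and "\<tau> > 0" and "x \<in> X"
  shows "- \<tau> * ln (real CARD('m)) \<le> v_smooth X f l \<tau> x"
  using v_smooth_ge[OF bdd_below_h_smooth[where f = f, OF assms(1-3)] assms(4), of x]
  by (simp add: h_smooth_diag[OF \<open>\<tau> > 0\<close>])

text \<open>
  At a minimizer of \<open>\<Sum>m. f m\<close> the differences \<open>f m y - f m x\<close> have a nonnegative mean, which makes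
  their smooth maximum at least \<open>\<tau> ln M\<close>, its value for \<open>y = x\<close>.
\<close>

lemma v_smooth_le_minus_ln_card_if_sum_minimal:
  fixes f :: "'m::finite \<Rightarrow> 'a::real_normed_vector \<Rightarrow> real"
  assumes "X \<noteq> {}" and "bdd_below (f m ` X)" and "l \<ge> 0" and "\<tau> > 0"
    and min: "\<And>y. y \<in> X \<Longrightarrow> (\<Sum>m\<in>UNIV. f m x) \<le> (\<Sum>m\<in>UNIV. f m y)"
  shows "v_smooth X f l \<tau> x \<le> - \<tau> * ln (real CARD('m))"
proof -
  have "\<tau> * ln (real CARD('m)) \<le> h_smooth f l \<tau> x y" if "y \<in> X" for y
  proof -
    have "0 \<le> (\<Sum>m\<in>UNIV. f m y - f m x) / real CARD('m)"
      using min[OF that] by (simp add: sum_subtractf)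
    then show ?thesis
      using mean_le_smooth_max[OF \<open>\<tau> > 0\<close>, of "\<lambda>m. f m y - f m x"]
        smooth_max_le_h_smooth[OF \<open>l \<ge> 0\<close>, of \<tau> f y x] by linarith
  qed
  then show ?thesis
    by (simp add: v_smooth_le_iff[OF \<open>X \<noteq> {}\<close> bdd_below_h_smooth[where f = f, OF assms(2-4)]])
qed

section \<open>Weak Pareto optimality\<close>

lemma weakly_pareto_optimal_iff:
  "weakly_pareto_optimal X f x \<longleftrightarrow> x \<in> X \<and> (\<forall>y\<in>X. \<exists>m. f m x \<le> f m y)"
  by (auto simp: weakly_pareto_optimal_def vec_less_def objective_vector_def not_less)

lemma v_smooth_nonpos_if_weakly_pareto_optimal:
  fixes f :: "'m::finite \<Rightarrow> 'a::real_normed_vector \<Rightarrow> real"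
  assumes wpo: "weakly_pareto_optimal X f x"
    and "bdd_below (f m0 ` X)" and "l \<ge> 0" and "\<tau> > 0"
  shows "v_smooth X f l \<tau> x \<le> 0"
proof -
  have "X \<noteq> {}"
    using wpo by (auto simp: weakly_pareto_optimal_iff)
  have "0 \<le> h_smooth f l \<tau> x y" if y: "y \<in> X" for y
  proof -
    obtain m where "f m x \<le> f m y"
      using wpo y by (auto simp: weakly_pareto_optimal_iff)
    then show ?thesis
      using le_smooth_max[OF \<open>\<tau> > 0\<close>, of "\<lambda>m. f m y - f m x" m]
        smooth_max_le_h_smooth[OF \<open>l \<ge> 0\<close>, of \<tau> f y x] by linarith
  qed
  then show ?thesis
    by (simp add: v_smooth_le_iff[OF \<open>X \<noteq> {}\<close> bdd_below_h_smooth[where f = f, OF assms(2-4)]])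
qed

text \<open>
  The tolerance \<open>\<tau> ln M\<close> is the excess of log-sum-exp over the maximum: if all differences lie
  below \<open>- \<tau> ln M\<close>, each of the \<open>M\<close> exponentials is less than \<open>1 / M\<close> and the logarithm of their
  sum is negative.
\<close>

lemma eps_weakly_pareto_optimal_if_v_smooth_nonpos:
  fixes f :: "'m::finite \<Rightarrow> 'a::real_normed_vector \<Rightarrow> real"
  assumes "x \<in> X" and bdd: "bdd_below (f m0 ` X)" and "\<tau> > 0"
    and v: "v_smooth X f 0 \<tau> x \<le> 0"
  shows "eps_weakly_pareto_optimal (\<tau> * ln (real CARD('m))) X f x"
proof -
  have False if y: "y \<in> X" and less: "\<And>m. f m y < f m x - \<tau> * ln (real CARD('m))" for y
  proof -
    have "f m y - f m x < - (\<tau> * ln (real CARD('m)))" for m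
      using less[of m] by linarith
    then have "smooth_max \<tau> (\<lambda>m. f m y - f m x)
        < smooth_max \<tau> (\<lambda>_::'m. - (\<tau> * ln (real CARD('m))))"
      by (rule smooth_max_strict_mono[OF \<open>\<tau> > 0\<close>])
    also have "\<dots> = 0"
      using smooth_max_const[OF \<open>\<tau> > 0\<close>, where 'm = 'm] by simp
    finally have "h_smooth f 0 \<tau> x y < 0"
      by (simp add: h_smooth_eq_smooth_max)
    then show False
      using v_smooth_ge[OF bdd_below_h_smooth[where f = f, OF bdd order_refl \<open>\<tau> > 0\<close>] y, of x] v by linarith
  qed
  then show ?thesis
    using \<open>x \<in> X\<close>
    by (force simp: eps_weakly_pareto_optimal_def vec_less_def objective_vector_def)
qed

text \<open>
  Along the segment from \<open>x\<close> to \<open>y\<close>, point quasar-convexity with constant \<open>1\<close> says that the secant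
  slope \<open>(\<phi> s - \<phi> 0) / s\<close> is at most \<open>\<phi>' s\<close>, so this slope has a nonnegative derivative and is
  largest at \<open>s = 1\<close>. The quasar inequality at the points of the segment only speaks of the gradients
  there; the monotonicity of the slope carries the information back towards \<open>x\<close>.
\<close>

lemma point_quasar_convex_below_chord:
  fixes f :: "'a::real_inner \<Rightarrow> real"
  assumes qc: "point_quasar_convex 1 \<mu> X f x" and "convex X" and "y \<in> X"
    and t: "0 < t" "t \<le> 1"
  shows "f (x + t *\<^sub>R (y - x)) - f x \<le> t * (f y - f x)"
proof -
  define p where "p s = x + s *\<^sub>R (y - x)" for s
  define \<phi> where "\<phi> s = f (p s)" for s
  have "x \<in> X"
    using qc by (simp add: point_quasar_convex_def)
  have pX: "p s \<in> X" if "s \<in> {0..1}" for s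
  proof -
    have "p s = (1 - s) *\<^sub>R x + s *\<^sub>R y"
      by (simp add: p_def algebra_simps)
    then show ?thesis
      using that \<open>convex X\<close> \<open>x \<in> X\<close> \<open>y \<in> X\<close> by (auto intro: convexD)
  qed
  have deriv: "\<exists>d. (\<phi> has_real_derivative d) (at s within {0..1}) \<and> \<phi> s - \<phi> 0 \<le> s * d"
    if s: "s \<in> {0..1}" for s
  proof -
    obtain g where g: "(f has_derivative (\<lambda>d. g \<bullet> d)) (at (p s) within X)"
      and ge: "f x \<ge> f (p s) + 1 / 1 * (g \<bullet> (x - p s)) + \<mu> / 2 * (norm (x - p s))\<^sup>2"
      using qc pX[OF s] unfolding point_quasar_convex_def by blast
    have dp: "(p has_derivative (\<lambda>h. h *\<^sub>R (y - x))) (at s within {0..1})"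
      unfolding p_def by (auto intro!: derivative_eq_intros)
    have "(f has_derivative (\<lambda>d. g \<bullet> d)) (at (p s) within p ` {0..1})"
      using g by (rule has_derivative_subset) (auto intro: pX)
    then have "(f \<circ> p has_derivative (\<lambda>d. g \<bullet> d) \<circ> (\<lambda>h. h *\<^sub>R (y - x))) (at s within {0..1})"
      by (rule diff_chain_within[OF dp])
    then have "(\<phi> has_real_derivative g \<bullet> (y - x)) (at s within {0..1})"
      by (simp add: has_field_derivative_def \<phi>_def[abs_def] o_def mult.commute[of _ "g \<bullet> (y - x)"])
    moreover have "0 \<le> \<mu> / 2 * (norm (x - p s))\<^sup>2"
      using qc by (simp add: point_quasar_convex_def)
    then have "\<phi> s - \<phi> 0 \<le> s * (g \<bullet> (y - x))"
      using ge by (simp add: \<phi>_def p_def)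
    ultimately show ?thesis
      by blast
  qed
  define \<psi> where "\<psi> s = (\<phi> s - \<phi> 0) / s" for s
  have "\<psi> t \<le> \<psi> 1"
  proof (rule DERIV_nonneg_imp_increasing_open[OF t(2)])
    fix s assume s: "t < s" "s < 1"
    obtain d where d: "(\<phi> has_real_derivative d) (at s within {0..1})"
      and le: "\<phi> s - \<phi> 0 \<le> s * d"
      using deriv[of s] s t by auto
    have "(\<phi> has_real_derivative d) (at s)"
      using d s t by (simp add: at_within_Icc_at)
    then have "(\<psi> has_real_derivative (d * s - (\<phi> s - \<phi> 0)) / (s * s)) (at s)"
      unfolding \<psi>_def using s t by (auto intro!: derivative_eq_intros)
    moreover have "0 \<le> (d * s - (\<phi> s - \<phi> 0)) / (s * s)"
      using le by (simp add: mult.commute)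
    ultimately show "\<exists>d. (\<psi> has_real_derivative d) (at s) \<and> 0 \<le> d"
      by blast
  next
    have "continuous_on {0..1} \<phi>"
      using deriv by (metis DERIV_continuous_on)
    then have "continuous_on {t..1} \<phi>"
      by (rule continuous_on_subset) (use t in auto)
    then show "continuous_on {t..1} \<psi>"
      unfolding \<psi>_def using t by (auto intro!: continuous_intros)
  qed
  then show ?thesis
    using t by (simp add: \<psi>_def \<phi>_def p_def divide_le_eq mult.commute)
qed

lemma weakly_pareto_optimal_if_v_smooth_minimal:
  fixes f :: "'m::finite \<Rightarrow> 'a::real_inner \<Rightarrow> real"
  assumes "x \<in> X" and "convex X" and bdd: "bdd_below (f m0 ` X)" and "l \<ge> 0" and "\<tau> > 0"
    and v: "v_smooth X f l \<tau> x \<le> - \<tau> * ln (real CARD('m))"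
    and qc: "\<And>m. point_quasar_convex 1 0 X (f m) x"
  shows "weakly_pareto_optimal X f x"
proof (rule ccontr)
  assume "\<not> weakly_pareto_optimal X f x"
  then obtain y where y: "y \<in> X" and less: "\<And>m. f m y < f m x"
    using \<open>x \<in> X\<close> by (auto simp: weakly_pareto_optimal_iff not_le)
  define c where "c = (MIN m. f m x - f m y)"
  have "c > 0"
    using less by (simp add: c_def)
  have c_le: "c \<le> f m x - f m y" for m
    by (simp add: c_def)
  define K where "K = l / 2 * (norm (y - x))\<^sup>2"
  have "K \<ge> 0"
    using \<open>l \<ge> 0\<close> by (simp add: K_def)
  (* The step is chosen so that the linear gain t * c exceeds the quadratic cost t\<^sup>2 * K. *)
  define t where "t = min 1 (c / (K + 1))"
  have t: "0 < t" "t \<le> 1"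
    using \<open>c > 0\<close> \<open>K \<ge> 0\<close> by (simp_all add: t_def)
  have "t * (K + 1) \<le> c"
    using \<open>K \<ge> 0\<close> by (simp add: t_def pos_le_divide_eq[symmetric])
  then have "t * K < c"
    using t by (simp add: distrib_left)
  then have gain: "t * (t * K) < t * c"
    using t by simp
  define z where "z = x + t *\<^sub>R (y - x)"
  have "z = (1 - t) *\<^sub>R x + t *\<^sub>R y"
    by (simp add: z_def algebra_simps)
  then have z: "z \<in> X"
    using t \<open>convex X\<close> \<open>x \<in> X\<close> y by (auto intro: convexD)
  have "f m z - f m x \<le> - (t * c)" for m
  proof -
    have "f m z - f m x \<le> t * (f m y - f m x)"
      unfolding z_def by (rule point_quasar_convex_below_chord[OF qc \<open>convex X\<close> y t])
    also have "\<dots> \<le> t * (- c)"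
      using t c_le[of m] by (intro mult_left_mono) auto
    finally show ?thesis
      by simp
  qed
  then have "smooth_max \<tau> (\<lambda>m. f m z - f m x) \<le> - (t * c) + \<tau> * ln (real CARD('m))"
    by (rule smooth_max_le[OF \<open>\<tau> > 0\<close>])
  moreover have "l / 2 * (norm (x - z))\<^sup>2 = t * (t * K)"
    by (simp add: z_def K_def power_mult_distrib power2_eq_square)
  ultimately have "h_smooth f l \<tau> x z < \<tau> * ln (real CARD('m))"
    using gain by (simp add: h_smooth_eq_smooth_max)
  then show False
    using v_smooth_ge[OF bdd_below_h_smooth[where f = f, OF bdd \<open>l \<ge> 0\<close> \<open>\<tau> > 0\<close>] z, of x] v by simp
qed

section \<open>Comparison, minimal value and optimality\<close>

theorem proposition3p3:
  fixes X :: "(real ^ 'q::finite) set"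
    and f :: "'m::finite \<Rightarrow> real ^ 'q \<Rightarrow> real"
    and l \<tau> :: real
  assumes "X \<noteq> {}" and "closed X" and "convex X"
    and "\<And>m. bdd_below (f m ` X)"
    and "\<And>m. twice_continuously_differentiable_on X (f m)"
    and "\<And>w. w \<in> prob_simplex \<Longrightarrow>
           \<exists>x. is_arg_min (\<lambda>y. w \<bullet> objective_vector f y) (\<lambda>y. y \<in> X) x"
    and "\<exists>\<mu>. \<forall>m. locally_lipschitz_on X (f m) \<and> weakly_convex_on \<mu> X (f m)"
    and "l \<ge> 0" and "\<tau> > 0"
  shows "(\<forall>x\<in>X. u_bar X f x - \<tau> * ln (real CARD('m)) \<le> v_smooth X f 0 \<tau> x \<and>
                v_smooth X f 0 \<tau> x \<le> u_bar X f x)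
       \<and> (\<exists>x. is_arg_min (v_smooth X f l \<tau>) (\<lambda>y. y \<in> X) x \<and>
              v_smooth X f l \<tau> x = - \<tau> * ln (real CARD('m)))
       \<and> (\<forall>x\<in>X. weakly_pareto_optimal X f x \<longrightarrow> v_smooth X f l \<tau> x \<le> 0)
       \<and> (\<forall>x\<in>X. l = 0 \<and> v_smooth X f l \<tau> x \<le> 0 \<longrightarrow>
              eps_weakly_pareto_optimal (\<tau> * ln (real CARD('m))) X f x)
       \<and> (\<forall>x\<in>X. l > 0 \<and> v_smooth X f l \<tau> x \<le> - \<tau> * ln (real CARD('m)) \<and>
              (\<forall>m. point_quasar_convex 1 0 X (f m) x) \<longrightarrow>
              weakly_pareto_optimal X f x)"
proof -
  note bdd = assms(4) and v_ge = v_smooth_ge_minus_ln_card[where f = f, OF assms(4,8,9)]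
  define w :: "real ^ 'm" where "w = (\<chi> m. 1 / real CARD('m))"
  have "w \<in> prob_simplex"
    by (simp add: w_def prob_simplex_def)
  then obtain x0 where "is_arg_min (\<lambda>y. w \<bullet> objective_vector f y) (\<lambda>y. y \<in> X) x0"
    using assms(6) by blast
  moreover have "w \<bullet> objective_vector f y = (\<Sum>m\<in>UNIV. f m y) / real CARD('m)" for y
    by (simp add: w_def objective_vector_def inner_vec_def sum_divide_distrib)
  ultimately have x0: "x0 \<in> X"
    and min: "\<And>y. y \<in> X \<Longrightarrow> (\<Sum>m\<in>UNIV. f m x0) \<le> (\<Sum>m\<in>UNIV. f m y)"
    by (auto simp: is_arg_min_linorder divide_le_cancel)
  have v0: "v_smooth X f l \<tau> x0 = - \<tau> * ln (real CARD('m))"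
    using v_smooth_le_minus_ln_card_if_sum_minimal[where f = f, OF assms(1,4,8,9) min] v_ge[OF x0]
    by (rule order_antisym)
  then have argmin: "is_arg_min (v_smooth X f l \<tau>) (\<lambda>y. y \<in> X) x0"
    using x0 v_ge by (auto simp: is_arg_min_linorder)
  show ?thesis
  proof (intro conjI ballI impI)
    show "u_bar X f x - \<tau> * ln (real CARD('m)) \<le> v_smooth X f 0 \<tau> x" for x
      by (rule u_bar_bounds_v_smooth(1)[where f = f, OF assms(1) bdd assms(9)])
    show "v_smooth X f 0 \<tau> x \<le> u_bar X f x" for x
      by (rule u_bar_bounds_v_smooth(2)[where f = f, OF assms(1) bdd assms(9)])
    show "\<exists>x. is_arg_min (v_smooth X f l \<tau>) (\<lambda>y. y \<in> X) x \<and>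
        v_smooth X f l \<tau> x = - \<tau> * ln (real CARD('m))"
      using argmin v0 by blast
    show "v_smooth X f l \<tau> x \<le> 0" if "weakly_pareto_optimal X f x" for x
      by (rule v_smooth_nonpos_if_weakly_pareto_optimal[where f = f, OF that bdd assms(8,9)])
    show "eps_weakly_pareto_optimal (\<tau> * ln (real CARD('m))) X f x"
      if "x \<in> X" and "l = 0 \<and> v_smooth X f l \<tau> x \<le> 0" for x
      using eps_weakly_pareto_optimal_if_v_smooth_nonpos[where f = f, OF that(1) bdd assms(9)] that(2) by auto
    show "weakly_pareto_optimal X f x"
      if "x \<in> X" and "l > 0 \<and> v_smooth X f l \<tau> x \<le> - \<tau> * ln (real CARD('m)) \<and>
        (\<forall>m. point_quasar_convex 1 0 X (f m) x)" for x
      using weakly_pareto_optimal_if_v_smooth_minimal[where f = f, OF that(1) assms(3) bdd assms(8,9)] that(2)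
      by blast
  qed
qed

end
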